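(* Let $\Psi$ be a set with $\emptyset \neq \Psi \subseteq \Phi$, where $\Phi$ is the set of binary relations on $\mathbb{R}^2$ defined in the context. Define the relation $R_\Psi \subseteq (\mathbb{R}^2 \times \Psi) \times (\mathbb{R}^2 \times \Psi)$ by: for all $x, y \in \mathbb{R}^2$ and all $S, Z \in \Psi$, $$((x,S),(y,Z)) \in R_\Psi \iff S = Z \text{ and } (x,y) \in S.$$ Put $A = \mathbb{R}^2 \times \Psi$. Then for all $a, b \in A$ with $a \neq b$ there exists a set $A(a,b)$ with $\{a\} \subseteq A(a,b) \subseteq A$ and $\operatorname{card} A(a,b) \leq \omega$ such that no map $f : A(a,b) \to A$ with $f(a) = b$ is a homomorphism of $R_\Psi$.
   Context: Let $p_0 = (0,0)$, $p_1 = (1,0)$, $p_2 = (\frac{1}{2}, \frac{\sqrt{3}}{2})$ be points of $\mathbb{R}^2$, and let $U = \{(a,b) \in \mathbb{R}^2 \times \mathbb{R}^2 : |a-b| = 1\}$, where $|\cdot|$ is the Euclidean norm. For a binary relation $R$, write $R^{-1} = \{(b,a) : (a,b) \in R\}$. Let $\Phi$ be the set of all relations $R \subseteq \mathbb{R}^2 \times \mathbb{R}^2$ such that $R \cup R^{-1} = U$, $R \cap R^{-1} = \{(p_0,p_1),(p_1,p_0),(p_0,p_2),(p_2,p_0)\}$, and $(p_1,p_2) \in R$. For a relation $R \subseteq A \times A$ and a subset $X \subseteq A$, a map $f : X \to A$ is called a homomorphism of $R$ if for all $u, v \in X$, $(u,v) \in R$ implies $(f(u), f(v)) \in R$. Here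 $\omega$ denotes the cardinal $\aleph_0$. The axiom of choice is assumed. *)

theory Defs
  imports "HOL-Analysis.Analysis"
begin

definition p0 :: "real ^ 2" where "p0 = vector [0, 0]"
definition p1 :: "real ^ 2" where "p1 = vector [1, 0]"
definition p2 :: "real ^ 2" where "p2 = vector [1 / 2, sqrt 3 / 2]"

definition U :: "(real ^ 2) rel" where
  "U = {(a, b). norm (a - b) = 1}"

definition Phi :: "(real ^ 2) rel set" where
  "Phi = {R. R \<union> R\<inverse> = U \<and>
             R \<inter> R\<inverse> = {(p0, p1), (p1, p0), (p0, p2), (p2, p0)} \<and>
             (p1, p2) \<in> R}"

definition R_rel :: "(real ^ 2) rel set \<Rightarrow> ((real ^ 2) \<times> (real ^ 2) rel) rel" where
  "R_rel \<Psi> = {((x, S), (y, Z)). S \<in> \<Psi> \<and> Z \<in> \<Psi> \<and> S = Z \<and> (x, y) \<in> S}"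

(* A map X \<rightarrow> A is represented by a total HOL function; only its values on X matter. *)
definition homomorphism_on :: "'a set \<Rightarrow> 'a rel \<Rightarrow> 'a set \<Rightarrow> ('a \<Rightarrow> 'a) \<Rightarrow> bool" where
  "homomorphism_on A R X f \<longleftrightarrow>
     f \<in> X \<rightarrow> A \<and> (\<forall>u\<in>X. \<forall>v\<in>X. (u, v) \<in> R \<longrightarrow> (f u, f v) \<in> R)"

end

theory Submission
  imports Defs
begin

text \<open>
  Every relation in \<open>Phi\<close> is an orientation of the unit-distance graph of the plane, so a
  homomorphism on a set \<open>X \<times> {S}\<close> sends points of \<open>X\<close> at distance 1 to points of a common layer
  at distance 1. The heart of the proof is a countable form of the Beckman--Quarles theorem: any two
  points of the plane lie in a countable set on which preserving distance 1 already forces their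
  distance to be preserved (\<open>forced_dist\<close>) and forces them into the same layer (\<open>forced_label\<close>).

  The forcing proceeds as follows. Unit rhombi yield the distance \<open>sqrt 3\<close>, and these together with
  the regular hexagon yield the distance 2. Preserving 1 and 2 means that arithmetic progressions
  of unit step are mapped to such progressions (\<open>forced_chain\<close>). Two progressions with a common
  origin turn a distance of \<open>j\<close> far from the origin into the distance \<open>j / k\<close> closer to it, which
  makes every rational distance rigid. Finally, a real distance is determined by the rational
  bounds that the triangle inequality gives through auxiliary points at rational distances.

  An orientation in \<open>Phi\<close> marks the triangle \<open>p0 p1 p2\<close>: its doubled edges meet in \<open>p0\<close> only, and
  the direction of the remaining edge tells \<open>p1\<close> from \<open>p2\<close>. Hence a homomorphism between two layers
  fixes the triangle (\<open>base_points_fixed\<close>), and where it is an isometry it is the identity. So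
  \<open>(x, S)\<close> cannot go to \<open>(y, S)\<close> with \<open>y \<noteq> x\<close>; and it cannot go to another layer \<open>Z\<close>, because \<open>S\<close> is
  not contained in \<open>Z\<close> (\<open>Phi_not_subset\<close>) and the two ends of an edge of \<open>S\<close> that is not in \<open>Z\<close> can be
  put among the points that are fixed.
\<close>

section \<open>Plane geometry\<close>

definition rot :: "real ^ 2 \<Rightarrow> real ^ 2" where
  "rot w = vector [- (w $ 2), w $ 1]"

lemma norm_rot_combination:
  "norm (a *\<^sub>R w + b *\<^sub>R rot w) = sqrt (a\<^sup>2 + b\<^sup>2) * norm w"
proof -
  have "(norm (a *\<^sub>R w + b *\<^sub>R rot w))\<^sup>2 = (a\<^sup>2 + b\<^sup>2) * (norm w)\<^sup>2"
    unfolding power2_norm_eq_inner inner_vec_def sum_2 rot_def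
    by (simp add: power2_eq_square algebra_simps)
  also have "\<dots> = (sqrt (a\<^sup>2 + b\<^sup>2) * norm w)\<^sup>2"
    by (simp add: power_mult_distrib)
  finally show ?thesis
    by (rule power2_eq_imp_eq) auto
qed

lemma dist_rot_combination:
  "dist (x + a *\<^sub>R w + b *\<^sub>R rot w) (x + c *\<^sub>R w + d *\<^sub>R rot w)
     = sqrt ((a - c)\<^sup>2 + (b - d)\<^sup>2) * norm w"
  unfolding dist_norm norm_rot_combination[symmetric] by (simp add: algebra_simps)

text \<open>
  The coordinates of the apex along and across the base are \<open>a\<close> and \<open>b\<close>, in units of the base; that
  \<open>b\<close> is real amounts to the product form of Heron's formula, whose factors are nonnegative by the
  triangle inequalities. The point may lie on the line through \<open>x\<close> and \<open>y\<close>.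
\<close>

lemma triangle_exists:
  fixes x y :: "real ^ 2"
  assumes "x \<noteq> y" "0 \<le> r" "0 \<le> s" "\<bar>r - s\<bar> \<le> dist x y" "dist x y \<le> r + s"
  obtains z where "dist x z = r" "dist y z = s"
proof -
  define w where "w = y - x"
  define d where "d = dist x y"
  define a where "a = (d\<^sup>2 + r\<^sup>2 - s\<^sup>2) / (2 * d\<^sup>2)"
  define b where "b = sqrt (r\<^sup>2 / d\<^sup>2 - a\<^sup>2)"
  have d: "d > 0" "norm w = d"
    using assms(1) by (auto simp: d_def w_def dist_norm norm_minus_commute)
  have "0 \<le> (s\<^sup>2 - (d - r)\<^sup>2) * ((d + r)\<^sup>2 - s\<^sup>2)"
  proof (rule mult_nonneg_nonneg)
    have "\<bar>d - r\<bar> \<le> s" "s \<le> d + r" using assms(4,5) by (auto simp: d_def)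
    then have "(d - r)\<^sup>2 \<le> s\<^sup>2" "s\<^sup>2 \<le> (d + r)\<^sup>2"
      using assms(3) by (auto intro: power_mono simp: abs_le_square_iff[symmetric])
    then show "0 \<le> s\<^sup>2 - (d - r)\<^sup>2" "0 \<le> (d + r)\<^sup>2 - s\<^sup>2" by auto
  qed
  also have "\<dots> = 4 * d\<^sup>2 * d\<^sup>2 * (r\<^sup>2 / d\<^sup>2 - a\<^sup>2)"
    using d(1) unfolding a_def by (simp add: field_simps) algebra
  finally have "0 \<le> r\<^sup>2 / d\<^sup>2 - a\<^sup>2"
    using d(1) by (simp add: zero_le_mult_iff)
  then have b: "b\<^sup>2 = r\<^sup>2 / d\<^sup>2 - a\<^sup>2" by (simp add: b_def)
  define z where "z = x + a *\<^sub>R w + b *\<^sub>R rot w"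
  have 1: "(a\<^sup>2 + b\<^sup>2) * d\<^sup>2 = r\<^sup>2" using d(1) b by simp
  have a: "a * (2 * d\<^sup>2) = d\<^sup>2 + r\<^sup>2 - s\<^sup>2" using d(1) by (simp add: a_def)
  have 2: "((1 - a)\<^sup>2 + b\<^sup>2) * d\<^sup>2 = s\<^sup>2"
  proof -
    have "((1 - a)\<^sup>2 + b\<^sup>2) * d\<^sup>2 = (a\<^sup>2 + b\<^sup>2) * d\<^sup>2 - a * (2 * d\<^sup>2) + d\<^sup>2"
      by (simp add: power2_eq_square algebra_simps)
    then show ?thesis using 1 a by simp
  qed
  have "dist x z = sqrt (a\<^sup>2 + b\<^sup>2) * d"
    using dist_rot_combination[of x 0 w 0 a b] d by (simp add: z_def)
  also have "\<dots> = sqrt ((a\<^sup>2 + b\<^sup>2) * d\<^sup>2)" using d by (simp add: real_sqrt_mult)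
  finally have xz: "dist x z = r" using 1 assms by simp
  have "dist y z = sqrt ((1 - a)\<^sup>2 + b\<^sup>2) * d"
    using dist_rot_combination[of x 1 w 0 a b] d by (simp add: z_def w_def)
  also have "\<dots> = sqrt (((1 - a)\<^sup>2 + b\<^sup>2) * d\<^sup>2)" using d by (simp add: real_sqrt_mult)
  finally have "dist y z = s" using 2 assms by simp
  with xz show ?thesis by (rule that)
qed

text \<open>
  The unit circles around \<open>A\<close> and \<open>B\<close> meet in two points only. The case \<open>X = Y\<close> is the folded
  rhombus, which unit distances between these four points cannot exclude.
\<close>

lemma rhombus_diagonal:
  fixes X Y A B :: "real ^ 2"
  assumes "dist X A = 1" "dist X B = 1" "dist Y A = 1" "dist Y B = 1" "dist A B = 1"
  shows "X = Y \<or> dist X Y = sqrt 3"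
proof -
  define P where "P = X - A"
  define Q where "Q = Y - A"
  define E where "E = B - A"
  have sq: "(P$1)\<^sup>2 + (P$2)\<^sup>2 = 1" "(Q$1)\<^sup>2 + (Q$2)\<^sup>2 = 1" "(E$1)\<^sup>2 + (E$2)\<^sup>2 = 1"
    "(P$1 - E$1)\<^sup>2 + (P$2 - E$2)\<^sup>2 = 1" "(Q$1 - E$1)\<^sup>2 + (Q$2 - E$2)\<^sup>2 = 1"
    using assms unfolding dist_vec_def L2_set_def sum_2
    by (auto simp: P_def Q_def E_def dist_real_def power2_commute)
  have dot: "P$1 * E$1 + P$2 * E$2 = 1/2" "Q$1 * E$1 + Q$2 * E$2 = 1/2"
    using sq by (auto simp: power2_eq_square algebra_simps)
  \<comment> \<open>The components of \<open>P\<close> and \<open>Q\<close> orthogonal to \<open>E\<close>; those along \<open>E\<close> agree by \<open>dot\<close>.\<close>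
  define p where "p = P$2 * E$1 - P$1 * E$2"
  define q where "q = Q$2 * E$1 - Q$1 * E$2"
  have p2: "p\<^sup>2 = 3/4" and q2: "q\<^sup>2 = 3/4"
  proof -
    have "p\<^sup>2 + (P$1 * E$1 + P$2 * E$2)\<^sup>2 = ((P$1)\<^sup>2 + (P$2)\<^sup>2) * ((E$1)\<^sup>2 + (E$2)\<^sup>2)"
      unfolding p_def by algebra
    then show "p\<^sup>2 = 3/4" unfolding sq dot by (simp add: power2_eq_square)
    have "q\<^sup>2 + (Q$1 * E$1 + Q$2 * E$2)\<^sup>2 = ((Q$1)\<^sup>2 + (Q$2)\<^sup>2) * ((E$1)\<^sup>2 + (E$2)\<^sup>2)"
      unfolding q_def by algebra
    then show "q\<^sup>2 = 3/4" unfolding sq dot by (simp add: power2_eq_square)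
  qed
  have "(P$1 - Q$1)\<^sup>2 + (P$2 - Q$2)\<^sup>2 = ((P$1 - Q$1)\<^sup>2 + (P$2 - Q$2)\<^sup>2) * ((E$1)\<^sup>2 + (E$2)\<^sup>2)"
    unfolding sq by simp
  also have "\<dots> = ((P$1 * E$1 + P$2 * E$2) - (Q$1 * E$1 + Q$2 * E$2))\<^sup>2 + (p - q)\<^sup>2"
    unfolding p_def q_def by algebra
  also have "\<dots> = (p - q)\<^sup>2" unfolding dot by simp
  finally have "dist X Y = sqrt ((p - q)\<^sup>2)"
    unfolding dist_vec_def L2_set_def sum_2
    by (simp add: P_def Q_def dist_real_def)
  moreover have "q = p \<or> q = - p" using p2 q2 by (metis power2_eq_iff)
  moreover have "(p - - p)\<^sup>2 = 3" using p2 by (simp add: power2_eq_square algebra_simps)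
  ultimately show ?thesis by (metis diff_self dist_eq_0_iff power_zero_numeral real_sqrt_zero)
qed

lemma dist_power2_inner:
  fixes x y :: "'a::real_inner"
  shows "(dist x y)\<^sup>2 = x \<bullet> x + y \<bullet> y - 2 * (x \<bullet> y)"
  by (simp add: dist_norm power2_norm_eq_inner inner_diff inner_commute)

text \<open>
  Seen from the centre \<open>M\<close>, the point \<open>X\<close> is the sum of \<open>A\<close> and \<open>B\<close>, because these are unit
  vectors at 120 degrees with \<open>X\<close> between them. Hence the inner product of \<open>Y\<close> with \<open>X\<close> is known
  as soon as those with \<open>A\<close> and \<open>B\<close> are.
\<close>

lemma hexagon_diameter:
  fixes M X Y A B :: "'a::real_inner"
  assumes "dist M X = 1" "dist M Y = 1" "dist M A = 1" "dist M B = 1"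
    and "dist A X = 1" "dist B X = 1"
    and "dist A B = sqrt 3" "dist Y A = sqrt 3" "dist Y B = sqrt 3"
  shows "dist X Y = 2"
proof -
  define a where "a = A - M"
  define b where "b = B - M"
  define x where "x = X - M"
  define y where "y = Y - M"
  have sq: "a \<bullet> a = 1" "b \<bullet> b = 1" "x \<bullet> x = 1" "y \<bullet> y = 1"
    using assms by (simp_all add: a_def b_def x_def y_def dist_norm norm_minus_commute
        power2_norm_eq_inner[symmetric])
  have d: "dist a x = 1" "dist b x = 1" "dist a b = sqrt 3" "dist y a = sqrt 3" "dist y b = sqrt 3"
    using assms by (simp_all add: a_def b_def x_def y_def dist_norm)
  have ax: "a \<bullet> x = 1/2" and bx: "b \<bullet> x = 1/2" and ab: "a \<bullet> b = -1/2"
    and ya: "y \<bullet> a = -1/2" and yb: "y \<bullet> b = -1/2"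
    using dist_power2_inner[of a x] dist_power2_inner[of b x] dist_power2_inner[of a b]
      dist_power2_inner[of y a] dist_power2_inner[of y b] unfolding d sq by simp_all
  have "(a + b - x) \<bullet> (a + b - x) = 0"
    using sq ax bx ab by (simp add: inner_diff inner_add inner_commute algebra_simps)
  then have "x = a + b" by simp
  then have "x \<bullet> y = -1" using ya yb by (simp add: inner_add inner_commute)
  then have "(dist x y)\<^sup>2 = 2\<^sup>2" unfolding dist_power2_inner sq by simp
  then have "dist x y = 2" by (rule power2_eq_imp_eq) auto
  then show ?thesis by (simp add: x_def y_def dist_norm)
qed

text \<open>
Equality in the triangle inequality: the two steps are parallel.
\<close>

lemma unit_steps_equal:
  fixes A B C :: "'a::real_inner"
  assumes "dist A B = 1" "dist B C = 1" "dist A C = 2"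
  shows "C - B = B - A"
proof -
  define P where "P = B - A"
  define Q where "Q = C - B"
  have "norm P = 1" "norm Q = 1" "norm (P + Q) = 2"
    using assms by (simp_all add: P_def Q_def dist_norm norm_minus_commute)
  then have "P \<bullet> P = 1" "Q \<bullet> Q = 1" "(P + Q) \<bullet> (P + Q) = 4"
    by (simp_all add: power2_norm_eq_inner[symmetric])
  then have "(Q - P) \<bullet> (Q - P) = 0"
    by (simp add: inner_add inner_diff inner_commute)
  then show ?thesis by (simp add: P_def Q_def)
qed

section \<open>Facts forced by countably many unit distances\<close>

text \<open>
  The second component of \<open>h\<close> stands for the layer in which the image of a point lies.
\<close>

definition unit_preserving :: "(real ^ 2) set \<Rightarrow> (real ^ 2 \<Rightarrow> (real ^ 2) \<times> 'b) \<Rightarrow> bool" where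
  "unit_preserving X h \<longleftrightarrow> (\<forall>u\<in>X. \<forall>v\<in>X. dist u v = 1 \<longrightarrow>
     dist (fst (h u)) (fst (h v)) = 1 \<and> snd (h u) = snd (h v))"

text \<open>
  A property holds eventually with respect to this filter iff it is forced by the unit distances
  within some countable set of points. Combining forced facts, which means taking unions of
  such sets, is thus left to the calculus of filters.
\<close>

definition unit_maps :: "(real ^ 2 \<Rightarrow> (real ^ 2) \<times> 'b) filter" where
  "unit_maps = (INF X\<in>{X. countable X}. principal {h. unit_preserving X h})"

lemma unit_preserving_subset: "unit_preserving Y h \<Longrightarrow> X \<subseteq> Y \<Longrightarrow> unit_preserving X h"
  by (auto simp: unit_preserving_def)

lemma eventually_unit_maps:
  "eventually P unit_maps \<longleftrightarrow> (\<exists>X. countable X \<and> (\<forall>h. unit_preserving X h \<longrightarrow> P h))"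
  unfolding unit_maps_def
proof (subst eventually_INF_base)
  fix X Y :: "(real ^ 2) set"
  assume "X \<in> {X. countable X}" "Y \<in> {X. countable X}"
  then show "\<exists>Z\<in>{X. countable X}. principal {h. unit_preserving Z h}
      \<le> inf (principal {h. unit_preserving X h}) (principal {h. unit_preserving Y h})"
    by (intro bexI[of _ "X \<union> Y"]) (auto intro: unit_preserving_subset)
qed (auto simp: eventually_principal)

text \<open>
  Unlike a general filter, this one is closed under countable intersections, since a countable union
  of countable sets is countable. Real distances can therefore be approached by infinitely many
  rational bounds at once.
\<close>

lemma eventually_unit_maps_countable_ball:
  assumes "countable I" "\<And>i. i \<in> I \<Longrightarrow> eventually (P i) unit_maps"
  shows "eventually (\<lambda>h. \<forall>i\<in>I. P i h) unit_maps"
proof -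
  have "\<forall>i\<in>I. \<exists>X. countable X \<and> (\<forall>h. unit_preserving X h \<longrightarrow> P i h)"
    using assms(2) by (simp add: eventually_unit_maps)
  then obtain X where X: "\<And>i. i \<in> I \<Longrightarrow> countable (X i)"
    "\<And>i h. i \<in> I \<Longrightarrow> unit_preserving (X i) h \<Longrightarrow> P i h"
    by metis
  show ?thesis unfolding eventually_unit_maps
  proof (intro exI[of _ "\<Union>i\<in>I. X i"] conjI allI impI ballI)
    show "countable (\<Union>i\<in>I. X i)" using assms(1) X(1) by auto
    show "P i h" if "unit_preserving (\<Union>i\<in>I. X i) h" "i \<in> I" for h i
      using that by (intro X(2)) (auto elim: unit_preserving_subset)
  qed
qed

lemma forced_unit:
  assumes "dist x y = 1"
  shows "\<forall>\<^sub>F h in unit_maps. dist (fst (h x)) (fst (h y)) = 1 \<and> snd (h x) = snd (h y)"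
  unfolding eventually_unit_maps
  using assms by (intro exI[of _ "{x, y}"]) (auto simp: unit_preserving_def)

lemma forced_dist_1:
  "dist x y = 1 \<Longrightarrow> \<forall>\<^sub>F h in unit_maps. dist (fst (h x)) (fst (h y)) = 1"
  by (drule forced_unit) (auto elim: eventually_mono)

lemma forced_dist_sqrt3_or_collapse:
  assumes "dist x y = sqrt 3"
  shows "\<forall>\<^sub>F h in unit_maps. fst (h x) = fst (h y) \<or> dist (fst (h x)) (fst (h y)) = sqrt 3"
proof -
  define w where "w = y - x"
  have w: "norm w = sqrt 3" using assms by (simp add: w_def dist_norm norm_minus_commute)
  \<comment> \<open>The other two vertices of the unit rhombus with long diagonal from \<open>x\<close> to \<open>y\<close>.\<close>
  define a where "a = x + (1/2) *\<^sub>R w + (1 / (2 * sqrt 3)) *\<^sub>R rot w"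
  define b where "b = x + (1/2) *\<^sub>R w + (- 1 / (2 * sqrt 3)) *\<^sub>R rot w"
  have y: "y = x + 1 *\<^sub>R w + 0 *\<^sub>R rot w" and x: "x = x + 0 *\<^sub>R w + 0 *\<^sub>R rot w"
    by (simp_all add: w_def)
  have *: "sqrt ((1/2)\<^sup>2 + (1 / (2 * sqrt 3))\<^sup>2) * sqrt 3 = 1"
    by (simp add: power_divide power_mult_distrib real_sqrt_mult[symmetric])
  have "dist x a = 1" "dist x b = 1" "dist y a = 1" "dist y b = 1" "dist a b = 1"
    using * dist_rot_combination[of x 0 w 0 "1/2" "1 / (2 * sqrt 3)"]
      dist_rot_combination[of x 0 w 0 "1/2" "- 1 / (2 * sqrt 3)"]
      dist_rot_combination[of x 1 w 0 "1/2" "1 / (2 * sqrt 3)"]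
      dist_rot_combination[of x 1 w 0 "1/2" "- 1 / (2 * sqrt 3)"]
      dist_rot_combination[of x "1/2" w "1 / (2 * sqrt 3)" "1/2" "- 1 / (2 * sqrt 3)"]
    unfolding a_def[symmetric] b_def[symmetric] y[symmetric] x[symmetric] w
    by simp_all
  from this[THEN forced_dist_1] show ?thesis
    by eventually_elim (rule rhombus_diagonal)
qed

text \<open>
  Rotating the rhombus about \<open>x\<close> until its far vertex has moved by distance 1 rules out that it
  folds: if \<open>x\<close> and \<open>y\<close> collapsed, then \<open>x\<close> and the new vertex \<open>z\<close> would be mapped to points at
  distance 1, but they have to be equal or at distance \<open>sqrt 3\<close>.
\<close>

lemma forced_dist_sqrt3:
  assumes "dist x y = sqrt 3"
  shows "\<forall>\<^sub>F h in unit_maps. dist (fst (h x)) (fst (h y)) = sqrt 3"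
proof -
  have "x \<noteq> y" using assms by auto
  moreover have "sqrt 3 \<ge> 1" by simp
  ultimately obtain z where z: "dist x z = sqrt 3" "dist y z = 1"
    using triangle_exists[of x y "sqrt 3" 1] assms by auto
  show ?thesis
    using forced_dist_sqrt3_or_collapse[OF assms] forced_dist_sqrt3_or_collapse[OF z(1)]
      forced_dist_1[OF z(2)]
    by eventually_elim auto
qed

lemma forced_dist_2:
  assumes "dist x y = 2"
  shows "\<forall>\<^sub>F h in unit_maps. dist (fst (h x)) (fst (h y)) = 2"
proof -
  define m where "m = midpoint x y"
  define w where "w = x - m"
  have w: "norm w = 1"
    using assms dist_midpoint(1)[of x y] by (simp add: w_def m_def dist_norm norm_minus_commute)
  \<comment> \<open>The neighbours of \<open>x\<close> in the regular hexagon with opposite vertices \<open>x\<close> and \<open>y\<close>.\<close>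
  define a where "a = m + (1/2) *\<^sub>R w + (sqrt 3 / 2) *\<^sub>R rot w"
  define b where "b = m + (1/2) *\<^sub>R w + (- sqrt 3 / 2) *\<^sub>R rot w"
  have m: "m = m + 0 *\<^sub>R w + 0 *\<^sub>R rot w" and x: "x = m + 1 *\<^sub>R w + 0 *\<^sub>R rot w"
    by (simp_all add: w_def)
  have y: "y = m + (- 1) *\<^sub>R w + 0 *\<^sub>R rot w"
    by (simp add: w_def m_def midpoint_def algebra_simps flip: scaleR_2)
  have d: "dist m x = 1" "dist m y = 1"
    "dist m a = 1" "dist m b = 1" "dist a x = 1" "dist b x = 1"
    "dist a b = sqrt 3" "dist y a = sqrt 3" "dist y b = sqrt 3"
    using dist_rot_combination[of m 0 w 0 1 0] dist_rot_combination[of m 0 w 0 "-1" 0]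
      dist_rot_combination[of m 0 w 0 "1/2" "sqrt 3 / 2"]
      dist_rot_combination[of m 0 w 0 "1/2" "- sqrt 3 / 2"]
      dist_rot_combination[of m "1/2" w "sqrt 3 / 2" 1 0]
      dist_rot_combination[of m "1/2" w "- sqrt 3 / 2" 1 0]
      dist_rot_combination[of m "1/2" w "sqrt 3 / 2" "1/2" "- sqrt 3 / 2"]
      dist_rot_combination[of m "-1" w 0 "1/2" "sqrt 3 / 2"]
      dist_rot_combination[of m "-1" w 0 "1/2" "- sqrt 3 / 2"]
    unfolding a_def[symmetric] b_def[symmetric] y[symmetric] x[symmetric] m[symmetric] w
    by (simp_all add: power_divide)
  show ?thesis
    using d(1-6)[THEN forced_dist_1] d(7-9)[THEN forced_dist_sqrt3]
    by eventually_elim (rule hexagon_diameter)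
qed

text \<open>
  Consecutive points of the progression are at distance 1 and every other one at distance 2, so
  all steps of the image are equal.
\<close>

lemma forced_chain:
  assumes "norm u = 1"
  shows "\<forall>\<^sub>F h in unit_maps.
    fst (h (p + real k *\<^sub>R u)) = fst (h p) + real k *\<^sub>R (fst (h (p + u)) - fst (h p))"
proof (induction k rule: induct_nat_012)
  case (ge2 k)
  let ?q = "\<lambda>i. p + real i *\<^sub>R u"
  have "dist (?q k) (?q (Suc k)) = 1" "dist (?q (Suc k)) (?q (Suc (Suc k))) = 1"
    "dist (?q k) (?q (Suc (Suc k))) = 2"
    using assms by (simp_all add: dist_norm scaleR_diff_left[symmetric])
  from this(1,2)[THEN forced_dist_1] this(3)[THEN forced_dist_2] ge2
  show ?case
  proof eventually_elim
    case (elim h)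
    define D where "D = fst (h (p + u)) - fst (h p)"
    have "fst (h (?q (Suc (Suc k)))) = fst (h (?q (Suc k))) + (fst (h (?q (Suc k))) - fst (h (?q k)))"
      using unit_steps_equal[OF elim(1-3)] by (simp add: algebra_simps)
    also have "\<dots> = fst (h p) + real (Suc (Suc k)) *\<^sub>R D"
      unfolding elim D_def[symmetric] by (simp add: scaleR_add_left scaleR_2)
    finally show ?case unfolding D_def .
  qed
qed simp_all

lemma forced_dist_nat:
  assumes "dist x y = real n"
  shows "\<forall>\<^sub>F h in unit_maps. dist (fst (h x)) (fst (h y)) = real n"
proof (cases "n = 0")
  case True
  then show ?thesis using assms by simp
next
  case False
  define u where "u = (y - x) /\<^sub>R real n"
  have u: "norm u = 1" and y: "y = x + real n *\<^sub>R u"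
    using assms False by (simp_all add: u_def dist_norm norm_minus_commute)
  have "dist x (x + u) = 1" using u by (simp add: dist_norm)
  from forced_dist_1[OF this] forced_chain[OF u, of x n]
  show ?thesis
  proof eventually_elim
    case (elim h)
    then have "norm (fst (h (x + u)) - fst (h x)) = 1" by (simp add: dist_norm norm_minus_commute)
    then show ?case using elim(2) unfolding y by (simp add: dist_norm)
  qed
qed

lemma apex_exists:
  fixes x y :: "real ^ 2"
  assumes "x \<noteq> y"
  obtains p u v and N :: nat where "N > 0" "norm u = 1" "norm v = 1"
    "x = p + real N *\<^sub>R u" "y = p + real N *\<^sub>R v"
proof -
  obtain N :: nat where N: "dist x y / 2 \<le> real N" using real_arch_simple by blast
  moreover have "N > 0"
  proof (rule ccontr)
    assume "\<not> N > 0"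
    then show False using N assms by simp
  qed
  ultimately obtain p where p: "dist x p = real N" "dist y p = real N"
    using triangle_exists[OF assms, of "real N" "real N"] by auto
  show ?thesis
    using p \<open>N > 0\<close>
    by (intro that[of N "(x - p) /\<^sub>R real N" "(y - p) /\<^sub>R real N" p]) (auto simp: dist_norm)
qed

text \<open>
  Both \<open>x\<close> and \<open>y\<close> are seen at the integral distance \<open>N\<close> from a common point \<open>p\<close>. Continuing the two
  rays to distance \<open>k * N\<close> magnifies the distance \<open>j / k\<close> to the integer \<open>j\<close>, which is preserved.
  As both rays are mapped to rays, the image can be scaled back.
\<close>

lemma forced_dist_rational:
  assumes "dist x y = real j / real k" "k > 0"
  shows "\<forall>\<^sub>F h in unit_maps. dist (fst (h x)) (fst (h y)) = real j / real k"
proof (cases "x = y")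
  case True
  then show ?thesis using assms by simp
next
  case False
  then obtain p u v N where N: "N > 0" and u: "norm u = 1" and v: "norm v = 1"
    and x: "x = p + real N *\<^sub>R u" and y: "y = p + real N *\<^sub>R v"
    by (rule apex_exists)
  let ?M = "k * N"
  have dxy: "norm (p + real n *\<^sub>R a - (p + real n *\<^sub>R b)) = real n * norm (a - b)"
    for n and p a b :: "real ^ 2"
    by (simp add: scaleR_diff_right[symmetric])
  have "dist (p + real ?M *\<^sub>R u) (p + real ?M *\<^sub>R v) = real k * dist x y"
    unfolding x y dist_norm dxy by simp
  also have "\<dots> = real j" using assms by simp
  finally have "dist (p + real ?M *\<^sub>R u) (p + real ?M *\<^sub>R v) = real j" .
  from forced_dist_nat[OF this] forced_chain[OF u, of p N] forced_chain[OF v, of p N]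
    forced_chain[OF u, of p ?M] forced_chain[OF v, of p ?M]
  show ?thesis
  proof eventually_elim
    case (elim h)
    define a where "a = fst (h (p + u)) - fst (h p)"
    define b where "b = fst (h (p + v)) - fst (h p)"
    have "real ?M * norm (a - b) = real j"
      using elim(1) unfolding elim(4,5) dist_norm a_def[symmetric] b_def[symmetric] dxy .
    moreover have "dist (fst (h x)) (fst (h y)) = real N * norm (a - b)"
      unfolding x y elim(2,3) dist_norm a_def[symmetric] b_def[symmetric] dxy ..
    ultimately show ?case using assms(2) by (simp add: field_simps)
  qed
qed

lemma forced_dist_Rats:
  assumes "dist x y = r" "r \<in> \<rat>"
  shows "\<forall>\<^sub>F h in unit_maps. dist (fst (h x)) (fst (h y)) = r"
proof -
  obtain j k :: nat where "k \<noteq> 0" "\<bar>r\<bar> = real j / real k"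
    using Rats_abs_nat_div_natE[OF assms(2)] by metis
  then show ?thesis
    using forced_dist_rational[of x y j k] assms zero_le_dist[of x y] by simp
qed

text \<open>
Through the apex of an isosceles triangle with legs \<open>r\<close>.
\<close>

lemma forced_dist_upper:
  assumes "x \<noteq> y" "r \<in> \<rat>" "dist x y \<le> 2 * r"
  shows "\<forall>\<^sub>F h in unit_maps. dist (fst (h x)) (fst (h y)) \<le> 2 * r"
proof -
  have "0 \<le> r" using assms(3) zero_le_dist[of x y] by linarith
  then obtain z where "dist x z = r" "dist y z = r"
    using triangle_exists[of x y r r] assms by auto
  from this[THEN forced_dist_Rats, OF assms(2)]
  show ?thesis by eventually_elim (metis dist_triangle3 dist_commute mult_2 dist_triangle2)
qed

text \<open>
  Through a point whose distances from \<open>x\<close> and \<open>y\<close> differ by \<open>t\<close>; it exists as soon as these distances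
  are large compared to the distance of \<open>x\<close> and \<open>y\<close>.
\<close>

lemma forced_dist_lower:
  assumes "x \<noteq> y" "t \<in> \<rat>" "0 \<le> t" "t \<le> dist x y"
  shows "\<forall>\<^sub>F h in unit_maps. t \<le> dist (fst (h x)) (fst (h y))"
proof -
  obtain N :: nat where N: "dist x y \<le> real N" using real_arch_simple by blast
  then obtain z where z: "dist x z = real N + t" "dist y z = real N"
    using triangle_exists[of x y "real N + t" "real N"] assms by auto
  have "real N + t \<in> \<rat>" "real N \<in> \<rat>" using assms(2) by auto
  from forced_dist_Rats[OF z(1) this(1)] forced_dist_Rats[OF z(2) this(2)]
  show ?thesis
  proof eventually_elim
    case (elim h)
    then show ?case using dist_triangle[of "fst (h x)" "fst (h z)" "fst (h y)"] by linarith
  qed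
qed

lemma forced_dist:
  "\<forall>\<^sub>F h :: real ^ 2 \<Rightarrow> (real ^ 2) \<times> 'a in unit_maps.
     dist (fst (h x)) (fst (h y)) = dist x y"
proof (cases "x = y")
  case False
  let ?I = "{r \<in> \<rat>. dist x y \<le> 2 * r}"
  let ?J = "{t \<in> \<rat>. 0 \<le> t \<and> t \<le> dist x y}"
  have "\<forall>\<^sub>F h :: real ^ 2 \<Rightarrow> (real ^ 2) \<times> 'a in unit_maps.
      \<forall>r\<in>?I. dist (fst (h x)) (fst (h y)) \<le> 2 * r"
  proof (rule eventually_unit_maps_countable_ball)
    show "countable ?I" by (rule countable_subset[OF _ countable_rat]) auto
  qed (simp add: forced_dist_upper[OF False])
  moreover have "\<forall>\<^sub>F h :: real ^ 2 \<Rightarrow> (real ^ 2) \<times> 'a in unit_maps.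
      \<forall>t\<in>?J. t \<le> dist (fst (h x)) (fst (h y))"
  proof (rule eventually_unit_maps_countable_ball)
    show "countable ?J" by (rule countable_subset[OF _ countable_rat]) auto
  qed (simp add: forced_dist_lower[OF False])
  ultimately show ?thesis
  proof eventually_elim
    case (elim h)
    let ?e = "dist (fst (h x)) (fst (h y))"
    show ?case
    proof (rule antisym; rule ccontr)
      assume "\<not> ?e \<le> dist x y"
      then obtain r where "r \<in> \<rat>" "dist x y / 2 < r" "r < ?e / 2"
        using Rats_dense_in_real[of "dist x y / 2" "?e / 2"] by auto
      with elim(1) show False by force
    next
      assume "\<not> dist x y \<le> ?e"
      then obtain t where "t \<in> \<rat>" "?e < t" "t < dist x y"
        using Rats_dense_in_real[of ?e "dist x y"] by auto
      moreover from this have "0 \<le> t" using zero_le_dist[of "fst (h x)" "fst (h y)"] by linarith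
      ultimately show False using elim(2) by force
    qed
  qed
qed simp

lemma forced_label_chain:
  assumes "norm u = 1"
  shows "\<forall>\<^sub>F h in unit_maps. snd (h (p + real k *\<^sub>R u)) = snd (h p)"
proof (induction k)
  case (Suc k)
  have "dist (p + real k *\<^sub>R u) (p + real (Suc k) *\<^sub>R u) = 1"
    using assms by (simp add: dist_norm scaleR_diff_left[symmetric])
  from Suc forced_unit[OF this] show ?case by eventually_elim simp
qed simp

text \<open>
Any two points are joined by a path of unit steps, through an apex as above.
\<close>

lemma forced_label: "\<forall>\<^sub>F h in unit_maps. snd (h x) = snd (h y)"
proof (cases "x = y")
  case False
  then obtain p u v N where "norm u = 1" "norm v = 1"
    "x = p + real N *\<^sub>R u" "y = p + real N *\<^sub>R v"
    by (rule apex_exists)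
  with forced_label_chain[of u p N] forced_label_chain[of v p N]
  show ?thesis by (auto elim: eventually_elim2)
qed simp

lemma countable_rigid_set:
  assumes "countable T"
  obtains X where "countable X" "T \<subseteq> X"
    "\<And>h :: real ^ 2 \<Rightarrow> (real ^ 2) \<times> 'b. unit_preserving X h \<Longrightarrow>
      \<forall>u\<in>T. \<forall>v\<in>T. dist (fst (h u)) (fst (h v)) = dist u v \<and> snd (h u) = snd (h v)"
proof -
  have "\<forall>\<^sub>F h :: real ^ 2 \<Rightarrow> (real ^ 2) \<times> 'b in unit_maps. \<forall>z\<in>T \<times> T.
      dist (fst (h (fst z))) (fst (h (snd z))) = dist (fst z) (snd z)
        \<and> snd (h (fst z)) = snd (h (snd z))"
  proof (rule eventually_unit_maps_countable_ball)
    show "countable (T \<times> T)" using assms by simp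
  qed (rule eventually_conj[OF forced_dist forced_label])
  then obtain X where X: "countable X \<and> (\<forall>h :: real ^ 2 \<Rightarrow> (real ^ 2) \<times> 'b.
      unit_preserving X h \<longrightarrow> (\<forall>z\<in>T \<times> T.
        dist (fst (h (fst z))) (fst (h (snd z))) = dist (fst z) (snd z)
        \<and> snd (h (fst z)) = snd (h (snd z))))"
    unfolding eventually_unit_maps ..
  show ?thesis
  proof (rule that[of "X \<union> T"])
    show "countable (X \<union> T)" using X assms by simp
    show "T \<subseteq> X \<union> T" by simp
    fix h :: "real ^ 2 \<Rightarrow> (real ^ 2) \<times> 'b"
    assume "unit_preserving (X \<union> T) h"
    then have "unit_preserving X h" by (rule unit_preserving_subset) simp
    with X have "\<forall>z\<in>T \<times> T. dist (fst (h (fst z))) (fst (h (snd z))) = dist (fst z) (snd z)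
        \<and> snd (h (fst z)) = snd (h (snd z))"
      by blast
    then show "\<forall>u\<in>T. \<forall>v\<in>T.
        dist (fst (h u)) (fst (h v)) = dist u v \<and> snd (h u) = snd (h v)"
      by (metis SigmaI fst_conv snd_conv)
  qed
qed

section \<open>The marked triangle\<close>

lemma base_points_distinct: "p0 \<noteq> p1" "p0 \<noteq> p2" "p1 \<noteq> p2"
  by (auto simp: p0_def p1_def p2_def vec_eq_iff forall_2)

lemma dist_base_points_unique:
  assumes "dist y p0 = dist x p0" "dist y p1 = dist x p1" "dist y p2 = dist x p2"
  shows "y = x"
proof -
  have sq: "(dist z w)\<^sup>2 = (z$1 - w$1)\<^sup>2 + (z$2 - w$2)\<^sup>2" for z w :: "real ^ 2"
    by (simp add: dist_vec_def L2_set_def sum_2 dist_real_def)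
  have 0: "(y$1)\<^sup>2 + (y$2)\<^sup>2 = (x$1)\<^sup>2 + (x$2)\<^sup>2"
    using assms(1) sq[of y p0] sq[of x p0] by (simp add: p0_def)
  have 1: "(y$1 - 1)\<^sup>2 + (y$2)\<^sup>2 = (x$1 - 1)\<^sup>2 + (x$2)\<^sup>2"
    using assms(2) sq[of y p1] sq[of x p1] by (simp add: p1_def)
  have 2: "(y$1 - 1/2)\<^sup>2 + (y$2 - sqrt 3 / 2)\<^sup>2 = (x$1 - 1/2)\<^sup>2 + (x$2 - sqrt 3 / 2)\<^sup>2"
    using assms(3) sq[of y p2] sq[of x p2] by (simp add: p2_def)
  have c1: "y$1 = x$1" using 0 1 by (simp add: power2_eq_square algebra_simps)
  then have "sqrt 3 * y$2 = sqrt 3 * x$2"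
    using 0 2 by (simp add: power2_eq_square algebra_simps)
  with c1 show ?thesis by (simp add: vec_eq_iff forall_2)
qed

lemma Phi_unit: "S \<in> Phi \<Longrightarrow> (x, y) \<in> S \<Longrightarrow> dist x y = 1"
  unfolding Phi_def U_def dist_norm by auto

lemma Phi_total: "S \<in> Phi \<Longrightarrow> dist x y = 1 \<Longrightarrow> (x, y) \<in> S \<or> (y, x) \<in> S"
  unfolding Phi_def U_def dist_norm by auto

lemma Phi_double:
  assumes "S \<in> Phi"
  shows "(x, y) \<in> S \<and> (y, x) \<in> S \<longleftrightarrow>
    (x, y) \<in> {(p0, p1), (p1, p0), (p0, p2), (p2, p0)}"
proof -
  have "S \<inter> S\<inverse> = {(p0, p1), (p1, p0), (p0, p2), (p2, p0)}"
    using assms unfolding Phi_def by blast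
  moreover have "(x, y) \<in> S \<and> (y, x) \<in> S \<longleftrightarrow> (x, y) \<in> S \<inter> S\<inverse>" by simp
  ultimately show ?thesis by (simp only:)
qed

lemma Phi_base_edges:
  assumes "S \<in> Phi"
  shows "(p0, p1) \<in> S" "(p1, p0) \<in> S" "(p0, p2) \<in> S" "(p2, p0) \<in> S"
    "(p1, p2) \<in> S" "(p2, p1) \<notin> S"
proof -
  show "(p0, p1) \<in> S" "(p1, p0) \<in> S" "(p0, p2) \<in> S" "(p2, p0) \<in> S"
    using Phi_double[OF assms] by auto
  show 12: "(p1, p2) \<in> S" using assms by (simp add: Phi_def)
  show "(p2, p1) \<notin> S"
    using Phi_double[OF assms, of p1 p2] 12 base_points_distinct by auto
qed

text \<open>
  Doubled edges go to doubled edges. The two at \<open>p0\<close> have distinct images, as \<open>p1\<close> and \<open>p2\<close> stay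
  at distance 1, so their common end \<open>p0\<close> is fixed; the direction of the edge from \<open>p1\<close> to \<open>p2\<close>
  excludes that these two points are exchanged.
\<close>

lemma base_points_fixed:
  assumes S: "S \<in> Phi" and Z: "Z \<in> Phi"
    and hom: "\<And>u v. u \<in> {p0, p1, p2} \<Longrightarrow> v \<in> {p0, p1, p2} \<Longrightarrow> (u, v) \<in> S \<Longrightarrow> (g u, g v) \<in> Z"
  shows "g p0 = p0" "g p1 = p1" "g p2 = p2"
proof -
  have e: "(g p0, g p1) \<in> {(p0, p1), (p1, p0), (p0, p2), (p2, p0)}"
    "(g p0, g p2) \<in> {(p0, p1), (p1, p0), (p0, p2), (p2, p0)}"
    using Phi_base_edges[OF S] hom by (intro Phi_double[OF Z, THEN iffD1] conjI; blast)+
  have 12: "(g p1, g p2) \<in> Z" using Phi_base_edges[OF S] hom by auto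
  then have "g p1 \<noteq> g p2" using Phi_unit[OF Z] by fastforce
  moreover have "(g p1, g p2) \<noteq> (p2, p1)" using 12 Phi_base_edges[OF Z] by auto
  ultimately show "g p0 = p0" "g p1 = p1" "g p2 = p2"
    using e base_points_distinct by auto
qed

text \<open>
  An edge \<open>(u, v)\<close> that \<open>Z\<close> has and \<open>S\<close> lacks occurs reversed in \<open>S\<close>. If \<open>S\<close> were contained in \<open>Z\<close>, this
  edge would be doubled in \<open>Z\<close>; but all members of \<open>Phi\<close> have the same doubled edges.
\<close>

lemma Phi_not_subset:
  assumes S: "S \<in> Phi" and Z: "Z \<in> Phi" and "S \<noteq> Z"
  shows "\<not> S \<subseteq> Z"
proof
  assume sub: "S \<subseteq> Z"
  with \<open>S \<noteq> Z\<close> obtain u v where uv: "(u, v) \<in> Z" "(u, v) \<notin> S" by auto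
  then have "(v, u) \<in> S" using Phi_unit[OF Z] Phi_total[OF S] by blast
  then have "(u, v) \<in> Z \<and> (v, u) \<in> Z" using uv sub by auto
  then have "(u, v) \<in> S \<and> (v, u) \<in> S"
    by (simp only: Phi_double[OF S] Phi_double[OF Z])
  then show False using uv by simp
qed

theorem theorem3:
  fixes \<Psi> :: "(real ^ 2) rel set"
    and A :: "((real ^ 2) \<times> (real ^ 2) rel) set"
  assumes "\<Psi> \<noteq> {}" and "\<Psi> \<subseteq> Phi"
    and "A = (UNIV :: (real ^ 2) set) \<times> \<Psi>"
  shows "\<forall>a\<in>A. \<forall>b\<in>A. a \<noteq> b \<longrightarrow>
           (\<exists>X. {a} \<subseteq> X \<and> X \<subseteq> A \<and> countable X \<and>
                \<not> (\<exists>f. f a = b \<and> homomorphism_on A (R_rel \<Psi>) X f))"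
proof (intro ballI impI)
  fix a b assume "a \<in> A" "b \<in> A" and "a \<noteq> b"
  then obtain x S y Z where a: "a = (x, S)" and b: "b = (y, Z)" and SZ: "S \<in> \<Psi>" "Z \<in> \<Psi>"
    using assms(3) by auto
  then have S: "S \<in> Phi" and Z: "Z \<in> Phi" using assms(2) by auto
  \<comment> \<open>An edge that witnesses \<open>S \<noteq> Z\<close> if the layers differ; any edge of \<open>S\<close> will do otherwise.\<close>
  obtain u v where uv: "(u, v) \<in> S" "S \<noteq> Z \<Longrightarrow> (u, v) \<notin> Z"
    using Phi_not_subset[OF S Z] Phi_base_edges(1)[OF S] by (cases "S = Z") auto
  define T where "T = {p0, p1, p2, x, u, v}"
  have "countable T" by (simp add: T_def)
  then obtain X where X: "countable X" "T \<subseteq> X"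
    and rigid: "\<And>h :: real ^ 2 \<Rightarrow> (real ^ 2) \<times> (real ^ 2) rel. unit_preserving X h \<Longrightarrow>
      \<forall>u\<in>T. \<forall>v\<in>T. dist (fst (h u)) (fst (h v)) = dist u v \<and> snd (h u) = snd (h v)"
    by (rule countable_rigid_set) (rule that)
  have "\<not> (\<exists>f. f a = b \<and> homomorphism_on A (R_rel \<Psi>) (X \<times> {S}) f)"
  proof
    assume "\<exists>f. f a = b \<and> homomorphism_on A (R_rel \<Psi>) (X \<times> {S}) f"
    then obtain f where fab: "f a = b" and "homomorphism_on A (R_rel \<Psi>) (X \<times> {S}) f" by blast
    then have edge: "(f (s, S), f (t, S)) \<in> R_rel \<Psi>"
      if "s \<in> X" "t \<in> X" "(s, t) \<in> S" for s t
      using that SZ by (auto simp: homomorphism_on_def R_rel_def)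
    define h where "h s = f (s, S)" for s
    have edge': "snd (h s) = snd (h t) \<and> (fst (h s), fst (h t)) \<in> snd (h s) \<and> snd (h s) \<in> Phi"
      if "s \<in> X" "t \<in> X" "(s, t) \<in> S" for s t
      using edge[OF that] assms(2) by (auto simp: R_rel_def h_def)
    have "unit_preserving X h"
      unfolding unit_preserving_def
    proof (intro ballI impI)
      fix s t assume st: "s \<in> X" "t \<in> X" "dist s t = 1"
      from Phi_total[OF S st(3)]
      show "dist (fst (h s)) (fst (h t)) = 1 \<and> snd (h s) = snd (h t)"
      proof
        assume "(s, t) \<in> S"
        then show ?thesis using edge'[OF st(1,2)] Phi_unit by blast
      next
        assume "(t, s) \<in> S"
        then show ?thesis using edge'[OF st(2,1)] Phi_unit by (metis dist_commute)
      qed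
    qed
    note rigid = rigid[OF this, rule_format]
    have hx: "h x = (y, Z)" using fab a b by (simp add: h_def)
    have label: "snd (h s) = Z" if "s \<in> T" for s
      using rigid[OF that, of x] hx by (simp add: T_def)
    define g where "g s = fst (h s)" for s
    have hom: "(g s, g t) \<in> Z" if "s \<in> T" "t \<in> T" "(s, t) \<in> S" for s t
      using edge'[of s t] label that X(2) by (auto simp: g_def)
    have base: "g p0 = p0" "g p1 = p1" "g p2 = p2"
      by (rule base_points_fixed[OF S Z, of g]; rule hom; auto simp: T_def)+
    have fixed: "g s = s" if "s \<in> T" for s
    proof (rule dist_base_points_unique)
      have "p0 \<in> T" "p1 \<in> T" "p2 \<in> T" by (auto simp: T_def)
      then show "dist (g s) p0 = dist s p0" "dist (g s) p1 = dist s p1" "dist (g s) p2 = dist s p2"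
        using rigid[OF that] base unfolding g_def by metis+
    qed
    have "x = y" using fixed[of x] hx by (simp add: g_def T_def)
    moreover have "(u, v) \<in> Z" using hom[of u v] fixed[of u] fixed[of v] uv(1) by (simp add: T_def)
    then have "S = Z" using uv(2) by blast
    ultimately show False using \<open>a \<noteq> b\<close> a b by simp
  qed
  moreover have "{a} \<subseteq> X \<times> {S}" "X \<times> {S} \<subseteq> A" "countable (X \<times> {S})"
    using X SZ a assms(3) by (auto simp: T_def)
  ultimately show "\<exists>X. {a} \<subseteq> X \<and> X \<subseteq> A \<and> countable X \<and>
      \<not> (\<exists>f. f a = b \<and> homomorphism_on A (R_rel \<Psi>) X f)" by blast
qed

end
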